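(* Let $G$ be a chordless graph and $M$ a matching in $G$. Then every subgraph $H$ of $G_M$ with at least two vertices contains at least two vertices of degree at most $2$ in $H$.
   Context: All graphs are finite, simple and undirected. A graph is chordless if no cycle of it has a chord. For a matching $M$ in $G$, $G[M]$ is the subgraph of $G$ induced by the endpoints of edges of $M$, and $G_M$ is the simple graph obtained from $G[M]$ by contracting each edge $e\in M$ to a vertex $v_e$ and removing parallel edges (so $v_ev_f\in E(G_M)$ iff some edge of $G$ joins an endpoint of $e$ to an endpoint of $f$). *)

theory Defs
  imports Main
begin

text \<open>A graph is a pair of a vertex set and an edge set, an edge being the two-element set of
  its endpoints.\<close>

type_synonym 'a ugraph = "'a set \<times> 'a set set"

abbreviation gverts :: "'a ugraph \<Rightarrow> 'a set"
  where "gverts G \<equiv> fst G"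

abbreviation gedges :: "'a ugraph \<Rightarrow> 'a set set"
  where "gedges G \<equiv> snd G"

definition simple_graph :: "'a ugraph \<Rightarrow> bool"
  where "simple_graph G \<longleftrightarrow>
    finite (gverts G) \<and> (\<forall>e\<in>gedges G. e \<subseteq> gverts G \<and> card e = 2)"

definition is_subgraph :: "'a ugraph \<Rightarrow> 'a ugraph \<Rightarrow> bool"
  where "is_subgraph H G \<longleftrightarrow>
    simple_graph H \<and> gverts H \<subseteq> gverts G \<and> gedges H \<subseteq> gedges G"

definition induced_by :: "'a ugraph \<Rightarrow> 'a set \<Rightarrow> 'a ugraph"
  where "induced_by G S = (gverts G \<inter> S, {e \<in> gedges G. e \<subseteq> S})"

definition gdegree :: "'a ugraph \<Rightarrow> 'a \<Rightarrow> nat"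
  where "gdegree G v = card {e \<in> gedges G. v \<in> e}"

text \<open>A cycle is given by the list of its vertices in cyclic order.\<close>

definition cycle_edges :: "'a list \<Rightarrow> 'a set set"
  where "cycle_edges c = {{c ! i, c ! (Suc i mod length c)} | i. i < length c}"

definition is_cycle :: "'a ugraph \<Rightarrow> 'a list \<Rightarrow> bool"
  where "is_cycle G c \<longleftrightarrow>
    3 \<le> length c \<and> distinct c \<and> set c \<subseteq> gverts G \<and> cycle_edges c \<subseteq> gedges G"

definition is_chord :: "'a ugraph \<Rightarrow> 'a list \<Rightarrow> 'a set \<Rightarrow> bool"
  where "is_chord G c e \<longleftrightarrow> e \<in> gedges G \<and> e \<subseteq> set c \<and> e \<notin> cycle_edges c"

definition chordless :: "'a ugraph \<Rightarrow> bool"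
  where "chordless G \<longleftrightarrow> (\<forall>c. is_cycle G c \<longrightarrow> \<not> (\<exists>e. is_chord G c e))"

definition is_matching :: "'a ugraph \<Rightarrow> 'a set set \<Rightarrow> bool"
  where "is_matching G M \<longleftrightarrow>
    M \<subseteq> gedges G \<and> (\<forall>e\<in>M. \<forall>f\<in>M. e \<noteq> f \<longrightarrow> e \<inter> f = {})"

definition matching_subgraph :: "'a ugraph \<Rightarrow> 'a set set \<Rightarrow> 'a ugraph"
  where "matching_subgraph G M = induced_by G (\<Union>M)"

text \<open>Contracting every edge of \<open>M\<close> in the subgraph induced by its endpoints: the edge \<open>e \<in> M\<close>
  itself serves as the vertex \<open>v\<^sub>e\<close> that it is contracted to. Requiring \<open>e \<noteq> f\<close> drops the loops,
  and parallel edges coincide because edges form a set.\<close>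

definition matching_contraction :: "'a ugraph \<Rightarrow> 'a set set \<Rightarrow> 'a set ugraph"
  where "matching_contraction G M =
    (M, {{e, f} | e f. e \<in> M \<and> f \<in> M \<and> e \<noteq> f \<and>
           (\<exists>x\<in>e. \<exists>y\<in>f. {x, y} \<in> gedges (matching_subgraph G M))})"

lemma matching_contraction_adj_iff:
  assumes "e \<in> M" "f \<in> M" "e \<noteq> f"
  shows "{e, f} \<in> gedges (matching_contraction G M) \<longleftrightarrow>
    (\<exists>x\<in>e. \<exists>y\<in>f. {x, y} \<in> gedges G)"
proof
  assume "{e, f} \<in> gedges (matching_contraction G M)"
  then obtain e' f' x y where *: "{e, f} = {e', f'}" "x \<in> e'" "y \<in> f'" "{x, y} \<in> gedges G"
    by (auto simp: matching_contraction_def matching_subgraph_def induced_by_def)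
  then show "\<exists>x\<in>e. \<exists>y\<in>f. {x, y} \<in> gedges G"
    by (metis doubleton_eq_iff insert_commute)
next
  assume "\<exists>x\<in>e. \<exists>y\<in>f. {x, y} \<in> gedges G"
  then obtain x y where "x \<in> e" "y \<in> f" "{x, y} \<in> gedges G" by blast
  then have "{x, y} \<in> gedges (matching_subgraph G M)"
    using assms by (auto simp: matching_subgraph_def induced_by_def)
  then show "{e, f} \<in> gedges (matching_contraction G M)"
    using assms \<open>x \<in> e\<close> \<open>y \<in> f\<close> unfolding matching_contraction_def by auto
qed

lemma simple_graph_matching_contraction:
  assumes "simple_graph G" "is_matching G M"
  shows "simple_graph (matching_contraction G M)"
proof -
  have "M \<subseteq> Pow (gverts G)"
    using assms by (auto simp: simple_graph_def is_matching_def)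
  then have "finite M"
    using assms(1) finite_subset by (auto simp: simple_graph_def)
  then show ?thesis
    by (fastforce simp: simple_graph_def matching_contraction_def intro: card_2_iff[THEN iffD2])
qed

end

theory Submission imports Defs begin

text \<open>Keep from \<open>G\<close> only the matching edges that are vertices of \<open>H\<close> and one edge of \<open>G\<close> for each
  edge of \<open>H\<close>. The result is chordless, so the ends of an edge are never joined by two further
  internally disjoint paths. Suppose that all vertices of \<open>H\<close> but at most one have degree at
  least 3, and explore the graph depth first from that one, always following a matching edge
  as soon as one of its ends is reached. Below a matching edge \<open>tb\<close> entered at \<open>t\<close> from \<open>p\<close>,
  chordlessness leaves at most one further way out of \<open>t\<close> and at most one out of \<open>b\<close> (a back edge or
  a subtree), hence, by the degree condition, exactly one each. Inductively, the way out of \<open>b\<close> is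
  a back edge, it reaches deepest among all edges from the part below \<open>p\<close> to the vertices above \<open>p\<close>,
  and together with the way out of \<open>t\<close> it forms two paths from \<open>t\<close> that are disjoint except at \<open>t\<close> and
  end at distinct vertices above \<open>p\<close>, neither of which is matched to \<open>p\<close>. Directly below the
  root edge there are no such vertices.\<close>

section \<open>Connected sets in a symmetric graph\<close>

locale sym_graph =
  fixes adj :: "'a \<Rightarrow> 'a \<Rightarrow> bool"
  assumes adj_sym: "adj x y \<Longrightarrow> adj y x"
begin

definition step_in :: "'a set \<Rightarrow> 'a \<Rightarrow> 'a \<Rightarrow> bool"
  where "step_in X a b \<longleftrightarrow> a \<in> X \<and> b \<in> X \<and> adj a b"

definition conn :: "'a set \<Rightarrow> bool"
  where "conn X \<longleftrightarrow> X \<noteq> {} \<and> (\<forall>x\<in>X. \<forall>y\<in>X. (step_in X)\<^sup>*\<^sup>* x y)"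

definition component_of :: "'a set \<Rightarrow> 'a \<Rightarrow> 'a set"
  where "component_of X k = {y. (step_in X)\<^sup>*\<^sup>* k y}"

text \<open>The inner vertices of a path are only recorded through the connected set \<open>W\<close> containing them,
  so that no lists have to be cut and glued.\<close>

definition reach :: "'a \<Rightarrow> 'a set \<Rightarrow> 'a \<Rightarrow> bool"
  where "reach x W y \<longleftrightarrow>
    W = {} \<and> adj x y \<or> conn W \<and> (\<exists>w\<in>W. adj x w) \<and> (\<exists>w\<in>W. adj w y)"

lemma step_in_mono: "(step_in X)\<^sup>*\<^sup>* x y \<Longrightarrow> X \<subseteq> Y \<Longrightarrow> (step_in Y)\<^sup>*\<^sup>* x y"
  by (rule rtranclp_mono[THEN predicate2D]) (auto simp: step_in_def)

lemma step_in_sym: "(step_in X)\<^sup>*\<^sup>* x y \<Longrightarrow> (step_in X)\<^sup>*\<^sup>* y x"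
  by (rule sympD[OF symp_rtranclp]) (auto simp: step_in_def symp_def adj_sym)

lemma conn_singleton [simp]: "conn {x}"
  by (auto simp: conn_def)

lemma conn_from: 
  assumes "z \<in> X" "\<And>x. x \<in> X \<Longrightarrow> (step_in X)\<^sup>*\<^sup>* z x"
  shows "conn X"
  unfolding conn_def using assms by (meson empty_iff rtranclp_trans step_in_sym)

lemma conn_Un:
  assumes "conn X" "conn Y" "X \<inter> Y \<noteq> {}"
  shows "conn (X \<union> Y)"
proof -
  from assms(3) obtain z where z: "z \<in> X" "z \<in> Y" by blast
  show ?thesis
  proof (rule conn_from[of z])
    fix x assume "x \<in> X \<union> Y"
    then have "(step_in X)\<^sup>*\<^sup>* z x \<or> (step_in Y)\<^sup>*\<^sup>* z x"
      using assms z by (auto simp: conn_def)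
    then show "(step_in (X \<union> Y))\<^sup>*\<^sup>* z x"
      by (auto intro: step_in_mono)
  qed (use z in auto)
qed

lemma conn_pair: "adj x y \<Longrightarrow> conn {x, y}"
  by (rule conn_from[of x]) (auto simp: step_in_def intro: r_into_rtranclp)

lemma conn_Un_adj:
  assumes "conn X" "conn Y" "x \<in> X" "y \<in> Y" "adj x y"
  shows "conn (X \<union> Y)"
proof -
  have "conn ((X \<union> {x, y}) \<union> Y)"
    using assms by (intro conn_Un conn_pair) auto
  moreover have "(X \<union> {x, y}) \<union> Y = X \<union> Y"
    using assms by auto
  ultimately show ?thesis by simp
qed

lemma conn_insert: "conn X \<Longrightarrow> x \<in> X \<Longrightarrow> adj x y \<Longrightarrow> conn (insert y X)"
  using conn_Un_adj[of X "{y}" x y] by simp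

lemma conn_segment:
  assumes "i \<le> j" "\<And>k. i \<le> k \<Longrightarrow> k < j \<Longrightarrow> adj (f k) (f (Suc k))"
  shows "conn (f ` {i..j})"
  using assms
proof (induction j rule: dec_induct)
  case (step j)
  then have "conn (insert (f (Suc j)) (f ` {i..j}))"
    by (intro conn_insert[of _ "f j"]) auto
  moreover have "insert (f (Suc j)) (f ` {i..j}) = f ` {i..Suc j}"
    using step by (simp add: atLeastAtMostSuc_conv)
  ultimately show ?case by simp
qed simp

lemma component_of_self [simp]: "k \<in> component_of X k"
  by (simp add: component_of_def)

lemma component_of_subset: "k \<in> X \<Longrightarrow> component_of X k \<subseteq> X"
proof
  fix y assume "k \<in> X" "y \<in> component_of X k"
  then have "(step_in X)\<^sup>*\<^sup>* k y" "k \<in> X" by (auto simp: component_of_def)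
  then show "y \<in> X" by (induction rule: rtranclp_induct) (auto simp: step_in_def)
qed

lemma component_of_closed:
  "k \<in> X \<Longrightarrow> x \<in> component_of X k \<Longrightarrow> adj x y \<Longrightarrow> y \<in> X \<Longrightarrow> y \<in> component_of X k"
  using component_of_subset[of k X] unfolding component_of_def
  by (metis (mono_tags, lifting) mem_Collect_eq rtranclp.rtrancl_into_rtrancl step_in_def subsetD)

lemma conn_component_of: "k \<in> X \<Longrightarrow> conn (component_of X k)"
proof (rule conn_from[of k])
  fix x assume k: "k \<in> X" and "x \<in> component_of X k"
  then have "(step_in X)\<^sup>*\<^sup>* k x" by (simp add: component_of_def)
  then show "(step_in (component_of X k))\<^sup>*\<^sup>* k x"
  proof (induction rule: rtranclp_induct)
    case (step y z)
    then have "step_in (component_of X k) y z"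
      using component_of_closed[OF k] by (auto simp: step_in_def component_of_def)
    with step show ?case by simp
  qed simp
qed simp

lemma conn_exit:
  assumes "conn X" "Y \<subseteq> X" "Y \<noteq> {}" "Y \<noteq> X"
  obtains x y where "x \<in> Y" "y \<in> X - Y" "adj x y"
proof -
  obtain a b where ab: "a \<in> Y" "b \<in> X - Y" using assms by blast
  then have "(step_in X)\<^sup>*\<^sup>* a b" using assms by (auto simp: conn_def)
  then have "b \<in> Y \<or> (\<exists>x y. x \<in> Y \<and> y \<in> X - Y \<and> adj x y)"
    by (induction rule: rtranclp_induct) (use ab in \<open>auto simp: step_in_def\<close>)
  with ab that show ?thesis by blast
qed

lemma reach_conn:
  assumes "reach x W y"
  shows "conn (insert y W)" "\<exists>w\<in>insert y W. adj x w"
  using assms by (auto simp: reach_def intro: conn_insert)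

text \<open>Cycles are lists, so at this one place walks inside a connected set are turned into
  duplicate-free lists: if the next vertex was visited before, the path is cut off right after
  it.\<close>

lemma step_in_path:
  assumes "(step_in X)\<^sup>*\<^sup>* a b" "a \<in> X"
  obtains xs where "xs \<noteq> []" "hd xs = a" "last xs = b" "distinct xs" "set xs \<subseteq> X"
    "successively adj xs"
proof -
  from assms have "\<exists>xs. xs \<noteq> [] \<and> hd xs = a \<and> last xs = b \<and> distinct xs \<and> set xs \<subseteq> X \<and>
      successively adj xs"
  proof (induction rule: rtranclp_induct)
    case base
    then show ?case by (intro exI[of _ "[a]"]) auto
  next
    case (step y z)
    then obtain xs where xs: "xs \<noteq> []" "hd xs = a" "last xs = y" "distinct xs" "set xs \<subseteq> X"
      "successively adj xs" by blast
    show ?case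
    proof (cases "z \<in> set xs")
      case True
      then obtain us vs where "xs = us @ z # vs" by (auto simp: in_set_conv_decomp)
      then have *: "xs = (us @ [z]) @ vs" by simp
      with xs(6) have "successively adj (us @ [z])"
        by (metis successively_append_iff)
      then show ?thesis using xs *
        by (intro exI[of _ "us @ [z]"]) (cases us; auto)
    next
      case False
      then show ?thesis using xs step
        by (intro exI[of _ "xs @ [z]"]) (auto simp: successively_append_iff step_in_def)
    qed
  qed
  with that show ?thesis by blast
qed

end

text \<open>A path from \<open>x\<close> to \<open>u\<close> through \<open>A\<close> and one back
  through \<open>B\<close> close up to a cycle on which \<open>x\<close> and \<open>u\<close> are
  not neighbours, so the edge \<open>xu\<close> is a chord of it.\<close>

lemma chordless_no_two_links:
  fixes G :: "'a ugraph"
  defines "adj \<equiv> \<lambda>x y. {x, y} \<in> gedges G"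
  assumes G: "simple_graph G" "chordless G"
    and xu: "adj x u"
    and A: "sym_graph.conn adj A" "x \<notin> A" "u \<notin> A" "a \<in> A" "adj x a" "a' \<in> A" "adj a' u"
    and B: "sym_graph.conn adj B" "x \<notin> B" "u \<notin> B" "b \<in> B" "adj u b" "b' \<in> B" "adj b' x"
    and disj: "A \<inter> B = {}"
  shows False
proof -
  interpret sym_graph adj
    by unfold_locales (simp add: adj_def insert_commute)
  obtain P where P: "P \<noteq> []" "hd P = a" "last P = a'" "distinct P" "set P \<subseteq> A"
    "successively adj P"
    using A step_in_path[of A a a'] unfolding conn_def by blast
  obtain Q where Q: "Q \<noteq> []" "hd Q = b" "last Q = b'" "distinct Q" "set Q \<subseteq> B"
    "successively adj Q"
    using B step_in_path[of B b b'] unfolding conn_def by blast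
  define c where "c = x # P @ u # Q"
  have len: "length c = length P + length Q + 2" by (simp add: c_def)
  have "x \<noteq> u"
    using xu G(1) by (auto simp: adj_def simple_graph_def)
  then have dist: "distinct c"
    using P Q A B disj by (auto simp: c_def)
  have succ: "successively adj c"
    using P Q A B by (simp add: c_def successively_append_iff successively_Cons)
  have last: "last c = b'" using Q by (simp add: c_def)
  have edges: "adj (c ! i) (c ! (Suc i mod length c))" if "i < length c" for i
  proof (cases "Suc i < length c")
    case True
    then show ?thesis using succ by (simp add: successively_conv_nth)
  next
    case False
    then have "i = length c - 1" "Suc i = length c" using that by auto
    then have "c ! i = b'" using last by (metis last_conv_nth list.size(3) that not_less_zero)
    then show ?thesis using B \<open>Suc i = length c\<close> by (simp add: c_def)
  qed
  have sub: "cycle_edges c \<subseteq> gedges G"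
    using edges by (auto simp: cycle_edges_def adj_def)
  have "set c \<subseteq> gverts G"
  proof
    fix y assume "y \<in> set c"
    then obtain i where "i < length c" "c ! i = y" by (auto simp: in_set_conv_nth)
    then have "adj y (c ! (Suc i mod length c))" using edges by blast
    then show "y \<in> gverts G" using G(1) by (auto simp: adj_def simple_graph_def)
  qed
  then have cyc: "is_cycle G c"
    using dist sub len P(1) by (cases P) (auto simp: is_cycle_def)
  \<comment> \<open>\<open>x\<close> stands at position 0 and \<open>u\<close> at
    \<open>Suc (length P)\<close>. Neither \<open>P\<close> nor \<open>Q\<close> is empty, so these
    positions are not consecutive, not even across the end of the list.\<close>
  have "{x, u} \<notin> cycle_edges c"
  proof
    assume "{x, u} \<in> cycle_edges c"
    then obtain i where i: "i < length c" "{x, u} = {c ! i, c ! (Suc i mod length c)}"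
      by (auto simp: cycle_edges_def)
    have x: "x = c ! 0" and u: "u = c ! Suc (length P)"
      by (auto simp: c_def nth_append)
    have m: "Suc i mod length c < length c" using len by simp
    from i(2) consider "x = c ! i" "u = c ! (Suc i mod length c)"
      | "u = c ! i" "x = c ! (Suc i mod length c)"
      by (auto simp: doubleton_eq_iff)
    then show False
    proof cases
      case 1
      then have "i = 0" "Suc i mod length c = Suc (length P)"
        using x u i(1) m dist len by (auto simp: nth_eq_iff_index_eq)
      then show False using len P(1) by simp
    next
      case 2
      then have "i = Suc (length P)" "Suc i mod length c = 0"
        using x u i(1) m dist len by (metis nth_eq_iff_index_eq less_add_Suc1 add_Suc_right add_2_eq_Suc' add_Suc add_gr_0 zero_less_Suc not_less_eq)+
      then show False using len Q(1) by auto
    qed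
  qed
  then have "is_chord G c {x, u}"
    using xu by (auto simp: is_chord_def adj_def c_def)
  with cyc G(2) show False by (auto simp: chordless_def)
qed


text \<open>\<open>m\<close> maps an end of a matching edge to its other end.
  \<open>no_two_links\<close> is chordlessness with paths replaced by connected sets;
  \<open>no_parallel\<close> reflects that a single edge is kept between any two matching
  edges.\<close>

locale chordless_mate = sym_graph adj for adj :: "'a \<Rightarrow> 'a \<Rightarrow> bool" +
  fixes m :: "'a \<Rightarrow> 'a"
  assumes adj_irrefl: "\<not> adj x x"
    and no_two_links: "\<lbrakk>adj x u; conn A; conn B; A \<inter> B = {}; x \<notin> A \<union> B; u \<notin> A \<union> B;
      \<exists>a\<in>A. adj x a; \<exists>a\<in>A. adj a u; \<exists>b\<in>B. adj x b; \<exists>b\<in>B. adj b u\<rbrakk> \<Longrightarrow> False"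
    and adj_mate: "adj x y \<Longrightarrow> adj x (m x)"
    and mate_mate: "adj x y \<Longrightarrow> m (m x) = x"
    and no_parallel: "adj x y \<Longrightarrow> y \<noteq> m x \<Longrightarrow> \<not> adj x (m y)"
      "adj x y \<Longrightarrow> y \<noteq> m x \<Longrightarrow> \<not> adj (m x) (m y)"
begin

lemma no_parallel': "adj x y \<Longrightarrow> y \<noteq> m x \<Longrightarrow> \<not> adj (m x) y"
  by (metis adj_sym mate_mate no_parallel(1))

section \<open>Ways out to the search path\<close>

definition path_upto :: "(nat \<Rightarrow> 'a) \<Rightarrow> nat \<Rightarrow> bool"
  where "path_upto f n \<longleftrightarrow> inj_on f {..n} \<and> (\<forall>i<n. adj (f i) (f (Suc i)))"

text \<open>By the meaning of \<open>reach\<close>, these are two paths from \<open>u\<close> to the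
  search path that share no inner vertex. They provide the two directions in which a cycle can leave
  \<open>u\<close> when \<open>u\<close> is to be the end of a chord.\<close>

definition fan :: "'a \<Rightarrow> 'a set \<Rightarrow> (nat \<Rightarrow> 'a) \<Rightarrow> nat \<Rightarrow> nat \<Rightarrow> bool"
  where "fan u X f lo hi \<longleftrightarrow> (\<exists>P Q. P \<subseteq> X - {u} \<and> Q \<subseteq> X - {u} \<and> P \<inter> Q = {} \<and>
    reach u P (f lo) \<and> reach u Q (f hi))"

text \<open>A way out of \<open>x\<close> to the path \<open>f 0, \<dots>, f n\<close>: either a back edge to \<open>u\<close> (then \<open>X = {}\<close>) or a
  part \<open>X\<close> of the graph entered at \<open>u\<close>. The root end of the path has index 0.\<close>

definition branch :: "(nat \<Rightarrow> 'a) \<Rightarrow> nat \<Rightarrow> 'a \<Rightarrow> 'a \<Rightarrow> 'a set \<Rightarrow> nat \<Rightarrow> nat \<Rightarrow> bool"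
  where "branch f n x u X lo hi \<longleftrightarrow> adj x u \<and> hi \<le> n \<and>
    (\<forall>y\<in>X. \<forall>i\<le>n. adj y (f i) \<longrightarrow> i \<le> hi) \<and>
    (X = {} \<and> u = f hi \<and> lo = hi \<or>
     conn X \<and> u \<in> X \<and> x \<notin> X \<and> X \<inter> f ` {..n} = {} \<and> lo < hi \<and> fan u X f lo hi)"

lemma path_upto_mono: "path_upto f n \<Longrightarrow> l \<le> n \<Longrightarrow> path_upto f l"
  by (auto simp: path_upto_def intro: inj_on_subset)

lemma path_upto_eq: "path_upto f n \<Longrightarrow> i \<le> n \<Longrightarrow> j \<le> n \<Longrightarrow> f i = f j \<longleftrightarrow> i = j"
  by (auto simp: path_upto_def inj_on_eq_iff)

lemma reach_source:
  assumes "reach x W y"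
  shows "conn (insert x W)" "\<exists>w\<in>insert x W. adj w y"
  using assms by (auto simp: reach_def intro: conn_insert adj_sym)

text \<open>Glues a link to a stretch of the search path; the two connected sets required by
  \<open>no_two_links\<close> are assembled from such pieces.\<close>

lemma reach_segment:
  assumes "path_upto f n" "reach x W (f j)" "a \<le> j" "j \<le> b" "b \<le> n"
  shows "conn (W \<union> f ` {a..b})" "\<exists>w\<in>W \<union> f ` {a..b}. adj x w"
proof -
  have "conn (insert (f j) W \<union> f ` {a..b})"
    using assms by (intro conn_Un reach_conn[of x] conn_segment) (auto simp: path_upto_def)
  moreover have eq: "insert (f j) W \<union> f ` {a..b} = W \<union> f ` {a..b}"
    using assms by auto
  ultimately show "conn (W \<union> f ` {a..b})" by simp
  show "\<exists>w\<in>W \<union> f ` {a..b}. adj x w"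
    using reach_conn(2)[OF assms(2)] eq by blast
qed

lemma branch_reach:
  assumes "branch f n x u X lo hi"
  shows "reach x X (f lo)" "reach x X (f hi)" "lo \<le> hi"
proof -
  have "reach x X y" if "conn X" "u \<in> X" "adj x u" "reach u Q y" "Q \<subseteq> X - {u}" for Q y
    using that unfolding reach_def by blast
  then show "reach x X (f lo)" "reach x X (f hi)" "lo \<le> hi"
    using assms unfolding branch_def fan_def by (auto simp: reach_def)
qed

text \<open>The edge \<open>xu\<close> would be a chord: the cycle leaves \<open>x\<close> through \<open>B\<close>, climbs the path from \<open>f l\<close> to
  \<open>f hi\<close>, passes through \<open>u\<close>, rejoins the path above \<open>f hi\<close> and returns to \<open>x\<close> through \<open>W\<close>.\<close>

lemma no_branch_between:
  assumes f: "path_upto f l" "x \<notin> f ` {..l}" "l \<le> n"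
    and br: "branch f n x u X lo hi"
    and B: "reach x B (f l)" and W: "reach x W (f k)" "B \<inter> W = {}"
    and disj: "(B \<union> W) \<inter> (insert x X \<union> f ` {..l}) = {}"
    and inner: "X \<noteq> {} \<Longrightarrow> k < hi \<and> hi \<le> l"
    and outer: "X = {} \<Longrightarrow> (k < hi \<or> k = hi \<and> W \<noteq> {}) \<and> (hi < l \<or> hi = l \<and> B \<noteq> {})"
  shows False
proof (cases "X = {}")
  case False
  with br obtain P Q where *: "adj x u" "conn X" "u \<in> X" "x \<notin> X" "X \<inter> f ` {..n} = {}" "lo < hi"
    "P \<subseteq> X - {u}" "Q \<subseteq> X - {u}" "P \<inter> Q = {}" "reach u P (f lo)" "reach u Q (f hi)"
    by (auto simp: branch_def fan_def)
  have k: "k < hi" "hi \<le> l" using inner[OF False] by auto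
  have sub: "f ` {hi..l} \<subseteq> f ` {..l}" "f ` {0..hi - 1} \<subseteq> f ` {..l}" "f ` {..l} \<subseteq> f ` {..n}"
    using k f(3) by auto
  have dd: "f ` {hi..l} \<inter> f ` {0..hi - 1} = {}"
    using f(1) k by (auto simp: path_upto_eq)
  \<comment> \<open>The path is split just above \<open>f hi\<close>. The lower stretch
    \<open>F\<close> joins \<open>B\<close> to \<open>Q\<close>, and the upper stretch
    \<open>E\<close> joins \<open>W\<close> to \<open>P\<close>; these unions are the two disjoint
    links from \<open>x\<close> to \<open>u\<close>.\<close>
  define F E where FE: "F = f ` {hi..l}" "E = f ` {0..hi - 1}"
  have sets: "F \<inter> E = {}" "(B \<union> W) \<inter> (X \<union> F \<union> E) = {}" "X \<inter> (F \<union> E) = {}" "x \<notin> B \<union> W \<union> F \<union> E \<union> X"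
  proof -
    define R where "R = f ` {..l}"
    have "X \<inter> R = {}" using sub *(5) unfolding R_def by blast
    moreover have "F \<subseteq> R" "E \<subseteq> R" "F \<inter> E = {}" "x \<notin> R" "(B \<union> W) \<inter> (insert x X \<union> R) = {}"
      using sub dd f(2) disj unfolding R_def FE by auto
    ultimately show "F \<inter> E = {}" "(B \<union> W) \<inter> (X \<union> F \<union> E) = {}" "X \<inter> (F \<union> E) = {}"
      "x \<notin> B \<union> W \<union> F \<union> E \<union> X"
      using *(4) by blast+
  qed
  have "f hi \<in> F" "f 0 \<in> E" using k by (auto simp: FE)
  then have ne: "(B \<union> F) \<inter> (Q \<union> F) \<noteq> {}" "(W \<union> E) \<inter> (P \<union> E) \<noteq> {}" by blast+
  have segB: "conn (B \<union> F)" "\<exists>w\<in>B \<union> F. adj x w" and segQ: "conn (Q \<union> F)" "\<exists>w\<in>Q \<union> F. adj u w"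
    using reach_segment[OF f(1) B, of hi l] reach_segment[OF f(1) *(11), of hi l] k
    by (auto simp: FE)
  have segW: "conn (W \<union> E)" "\<exists>w\<in>W \<union> E. adj x w" and segP: "conn (P \<union> E)" "\<exists>w\<in>P \<union> E. adj u w"
    using reach_segment[OF f(1) W(1), of 0 "hi - 1"] k *(6)
      reach_segment[OF f(1) *(10), of 0 "hi - 1"]
    by (auto simp: FE)
  show False
  proof (rule no_two_links[OF \<open>adj x u\<close>])
    show "conn ((B \<union> F) \<union> (Q \<union> F))"
      by (rule conn_Un[OF segB(1) segQ(1) ne(1)])
    show "conn ((W \<union> E) \<union> (P \<union> E))"
      by (rule conn_Un[OF segW(1) segP(1) ne(2)])
    show "(B \<union> F \<union> (Q \<union> F)) \<inter> (W \<union> E \<union> (P \<union> E)) = {}"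
    proof -
      have "Q \<inter> (W \<union> E) = {}" "P \<inter> (B \<union> F) = {}" using sets(2,3) *(7,8) by auto
      moreover have "(B \<union> F) \<inter> (W \<union> E) = {}" using sets(1,2) W(2) by auto
      ultimately show ?thesis using *(9) by auto
    qed
    show "x \<notin> B \<union> F \<union> (Q \<union> F) \<union> (W \<union> E \<union> (P \<union> E))"
      using sets *(3,7,8) by blast
    show "u \<notin> B \<union> F \<union> (Q \<union> F) \<union> (W \<union> E \<union> (P \<union> E))"
      using sets *(3,7,8) by blast
    show "\<exists>a\<in>B \<union> F \<union> (Q \<union> F). adj x a"
      using segB(2) by blast
    show "\<exists>a\<in>B \<union> F \<union> (Q \<union> F). adj a u"
      using segQ(2) adj_sym by blast
    show "\<exists>b\<in>W \<union> E \<union> (P \<union> E). adj x b"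
      using segW(2) by blast
    show "\<exists>b\<in>W \<union> E \<union> (P \<union> E). adj b u"
      using segP(2) adj_sym by blast
  qed
next
  case True
  with br have u: "adj x u" "u = f hi" by (auto simp: branch_def)
  have k: "k < hi \<or> k = hi \<and> W \<noteq> {}" "hi < l \<or> hi = l \<and> B \<noteq> {}" using outer[OF True] by auto
  \<comment> \<open>Now \<open>u\<close> is itself a path vertex, so one link arrives at it from
    below and one from above. If \<open>hi = l\<close> there is no stretch below, and
    \<open>B\<close> alone has to serve; likewise \<open>W\<close> alone if
    \<open>k = hi\<close>.\<close>
  have "\<exists>C. conn C \<and> C \<subseteq> B \<union> f ` {Suc hi..l} \<and> (\<exists>a\<in>C. adj x a) \<and> (\<exists>a\<in>C. adj a u)"
  proof (cases "hi < l")
    case True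
    then have "adj (f (Suc hi)) u" using f(1) u(2) by (auto simp: path_upto_def intro: adj_sym)
    then show ?thesis using reach_segment[OF f(1) B, of "Suc hi" l] True
      by (intro exI[of _ "B \<union> f ` {Suc hi..l}"]) auto
  next
    case False
    then show ?thesis using k B u by (intro exI[of _ B]) (auto simp: reach_def)
  qed
  then obtain C where C: "conn C" "C \<subseteq> B \<union> f ` {Suc hi..l}" "\<exists>a\<in>C. adj x a" "\<exists>a\<in>C. adj a u"
    by blast
  have "\<exists>D. conn D \<and> D \<subseteq> W \<union> f ` {..<hi} \<and> (\<exists>a\<in>D. adj x a) \<and> (\<exists>a\<in>D. adj a u)"
  proof (cases "k < hi")
    case True
    then have "adj (f (hi - 1)) u" using f(1) u(2) k
      by (auto simp: path_upto_def dest!: spec[of _ "hi - 1"])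
    then show ?thesis using reach_segment[OF f(1) W(1), of 0 "hi - 1"] True k
      by (intro exI[of _ "W \<union> f ` {0..hi - 1}"]) (auto simp: le_diff_conv2)
  next
    case False
    then show ?thesis using k W u by (intro exI[of _ W]) (auto simp: reach_def)
  qed
  then obtain D where D: "conn D" "D \<subseteq> W \<union> f ` {..<hi}" "\<exists>a\<in>D. adj x a" "\<exists>a\<in>D. adj a u"
    by blast
  have hi: "hi \<le> l" using k by auto
  define R E F where R: "R = f ` {..l}" and E: "E = f ` {..<hi}" and F: "F = f ` {Suc hi..l}"
  have sub: "F \<subseteq> R" "E \<subseteq> R" "u \<in> R" "x \<notin> R" "(B \<union> W) \<inter> (insert x X \<union> R) = {}"
    using hi u f(2) disj by (auto simp: R E F)
  have dd: "F \<inter> E = {}" "u \<notin> F" "u \<notin> E"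
    using f(1) u hi by (auto simp: path_upto_eq E F)
  note CD = C(2)[folded F] D(2)[folded E]
  show False
  proof (rule no_two_links[OF u(1) C(1) D(1)])
    have "B \<inter> E = {}" "W \<inter> F = {}" using sub(1,2,5) by auto
    then have "(B \<union> F) \<inter> (W \<union> E) = {}" using dd(1) W(2) by (simp add: Int_Un_distrib Int_Un_distrib2 Int_commute)
    then show "C \<inter> D = {}" using CD by (meson disjoint_iff subsetD)
    show "x \<notin> C \<union> D" using sub CD by blast
    show "u \<notin> C \<union> D" using dd sub CD by blast
  qed (fact C(3,4) D(3,4))+
qed

text \<open>Of two ways out, one serves as the link \<open>W\<close> in
  \<open>no_branch_between\<close> while the other contains the forbidden chord. The condition
  \<open>low\<close> prevents a back edge to \<open>f n\<close> from coinciding with a direct link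
  from \<open>x\<close> to \<open>f n\<close>.\<close>

lemma branch_unique_le:
  assumes f: "path_upto f n" "x \<notin> f ` {..n}"
    and br: "branch f n x u1 X1 lo1 hi1" "branch f n x u2 X2 lo2 hi2" "X1 \<inter> X2 = {}"
    and B: "reach x B (f n)" "B \<inter> (insert x (X1 \<union> X2) \<union> f ` {..n}) = {}"
    and low: "f n \<noteq> u1 \<or> B \<noteq> {}" "f n \<noteq> u2 \<or> B \<noteq> {}"
    and le: "hi1 \<le> hi2"
  shows "u1 = u2"
proof (rule ccontr)
  assume ne: "u1 \<noteq> u2"
  note reach = branch_reach[OF br(1)] branch_reach[OF br(2)]
  have hi: "hi1 \<le> n" "hi2 \<le> n" using br by (auto simp: branch_def)
  have X: "X1 \<inter> insert x (f ` {..n}) = {}" "X2 \<inter> insert x (f ` {..n}) = {}"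
    using br by (auto simp: branch_def)
  show False
  proof (cases "lo1 < hi2 \<or> X2 = {}")
    case True
    show False
    proof (rule no_branch_between[OF f le_refl br(2) B(1) reach(1)])
      show "X2 = {} \<Longrightarrow> (lo1 < hi2 \<or> lo1 = hi2 \<and> X1 \<noteq> {}) \<and> (hi2 < n \<or> hi2 = n \<and> B \<noteq> {})"
        using br ne low hi le by (auto simp: branch_def)
    qed (use True B X br(3) hi in auto)
  next
    case False
    \<comment> \<open>Here \<open>hi2 \<le> lo1 \<le> hi1 \<le> hi2\<close>, so the first branch is
      a back edge to \<open>f hi2\<close>, and the second one also ends strictly above that vertex.
      Hence the roles are exchanged.\<close>
    show False
    proof (rule no_branch_between[OF f le_refl br(1) B(1) reach(4)])
      show "X1 = {} \<Longrightarrow> (lo2 < hi1 \<or> lo2 = hi1 \<and> X2 \<noteq> {}) \<and> (hi1 < n \<or> hi1 = n \<and> B \<noteq> {})"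
        using br ne low hi le False by (auto simp: branch_def)
      show "X1 \<noteq> {} \<Longrightarrow> lo2 < hi1 \<and> hi1 \<le> n"
        using br le False by (auto simp: branch_def)
    qed (use B X br(3) hi in auto)
  qed
qed

lemma branch_unique:
  assumes "path_upto f n" "x \<notin> f ` {..n}"
    and "branch f n x u1 X1 lo1 hi1" "branch f n x u2 X2 lo2 hi2" "X1 \<inter> X2 = {}"
    and "reach x B (f n)" "B \<inter> (insert x (X1 \<union> X2) \<union> f ` {..n}) = {}"
    and "f n \<noteq> u1 \<or> B \<noteq> {}" "f n \<noteq> u2 \<or> B \<noteq> {}"
  shows "u1 = u2"
proof (cases "hi1 \<le> hi2")
  case True
  then show ?thesis using branch_unique_le[OF assms] by blast
next
  case False
  then show ?thesis
    using branch_unique_le[OF assms(1,2,4,3) _ assms(6) _ assms(9,8)] assms(5,7)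
    by (metis Int_commute Un_commute nle_le)
qed

section \<open>Induction over the unexplored parts of the search\<close>

text \<open>\<open>S\<close> is an unexplored part entered at \<open>t\<close> when the search stands at \<open>f n\<close>.\<close>

definition attached :: "'a set \<Rightarrow> (nat \<Rightarrow> 'a) \<Rightarrow> nat \<Rightarrow> 'a \<Rightarrow> bool"
  where "attached S f n t \<longleftrightarrow> finite S \<and> conn S \<and> (\<forall>x\<in>S. m x \<in> S \<and> adj x (m x)) \<and>
    t \<in> S \<and> adj t (f n) \<and> path_upto f n \<and> S \<inter> f ` {..n} = {} \<and>
    (\<forall>x\<in>S. \<forall>y. adj x y \<longrightarrow> y \<in> S \<union> f ` {..n})"

text \<open>The condition on the matching edge \<open>{x, m x}\<close> that degree at least 3 in
  \<open>H\<close> provides, counted in vertices next to that edge.\<close>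

definition nonlow :: "'a \<Rightarrow> bool"
  where "nonlow x \<longleftrightarrow> 3 \<le> card ({y. adj x y \<or> adj (m x) y} - {x, m x})"

text \<open>The last clause excludes a further link from \<open>t\<close>, outside \<open>S\<close>, to a vertex above everything that
  \<open>S\<close> sees; one level up it forces the way out of the lower end of a matching edge to be a back
  edge.\<close>

definition ear :: "'a set \<Rightarrow> (nat \<Rightarrow> 'a) \<Rightarrow> nat \<Rightarrow> 'a \<Rightarrow> bool"
  where "ear S f n t \<longleftrightarrow>
    (\<forall>x\<in>S. adj x (f n) \<longrightarrow> x = t) \<and>
    (\<forall>k. n = Suc k \<longrightarrow> f k = m (f n) \<longrightarrow> (\<forall>x\<in>S. \<not> adj x (f k))) \<and>
    (\<exists>lo hi. lo < hi \<and> hi < n \<and> (\<forall>x\<in>S. \<forall>i<n. adj x (f i) \<longrightarrow> i \<le> hi) \<and> fan t S f lo hi) \<and>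
    (\<forall>Z k. Z \<inter> S = {} \<longrightarrow> reach t Z (f k) \<longrightarrow>
      \<not> (\<forall>x\<in>S. \<forall>i<n. adj x (f i) \<longrightarrow> k < i \<and> f ` {..i} \<inter> Z = {}))"

lemma ear_no_link:
  assumes "ear S f n t" "Z \<inter> S = {}" "reach t Z (f k)"
    "\<And>x i. x \<in> S \<Longrightarrow> i < n \<Longrightarrow> adj x (f i) \<Longrightarrow> k < i \<and> f ` {..i} \<inter> Z = {}"
  shows False
proof -
  from assms(1) have "Z \<inter> S = {} \<longrightarrow> reach t Z (f k) \<longrightarrow>
      \<not> (\<forall>x\<in>S. \<forall>i<n. adj x (f i) \<longrightarrow> k < i \<and> f ` {..i} \<inter> Z = {})"
    unfolding ear_def by (elim conjE allE)
  with assms(2-) show False by simp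
qed

lemma ear_branch:
  assumes K: "attached K g n' s" "ear K g n' s"
    and g: "\<And>i. i \<le> n \<Longrightarrow> g i = f i" "g n' = x" "n < n'"
    and none: "\<And>i y. n < i \<Longrightarrow> i < n' \<Longrightarrow> y \<in> K \<Longrightarrow> \<not> adj y (g i)"
  obtains lo hi where "branch f n x s K lo hi"
proof -
  from K(2) obtain lo hi P Q where *: "lo < hi" "hi < n'" "\<forall>y\<in>K. \<forall>i<n'. adj y (g i) \<longrightarrow> i \<le> hi"
    "P \<subseteq> K - {s}" "Q \<subseteq> K - {s}" "P \<inter> Q = {}" "reach s P (g lo)" "reach s Q (g hi)"
    by (auto simp: ear_def fan_def)
  have s: "s \<in> K" "adj s x" "x \<notin> K" "conn K" "K \<inter> g ` {..n'} = {}"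
    using K(1) g(2) by (auto simp: attached_def)
  from reach_source(2)[OF *(8)] *(5) s(1) obtain w where "w \<in> K" "adj w (g hi)" by blast
  with none *(2) have hi: "hi \<le> n" by (meson not_le)
  have "f ` {..n} = g ` {..n}" using g(1) by auto
  then have "K \<inter> f ` {..n} = {}" using s(5) g(3) by auto
  moreover have "fan s K f lo hi"
    unfolding fan_def using * hi g(1) by (intro exI[of _ P] exI[of _ Q]) auto
  ultimately have "branch f n x s K lo hi"
    using * s hi g by (auto simp: branch_def intro: adj_sym)
  with that show ?thesis .
qed

lemma component_of_disjoint:
  "y \<in> component_of X u \<Longrightarrow> y \<in> component_of X v \<Longrightarrow> v \<in> component_of X u"
  unfolding component_of_def by (metis mem_Collect_eq rtranclp_trans step_in_sym)

text \<open>Deleting the matching edge \<open>tb\<close> at the entrance splits \<open>S\<close>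
  into smaller parts, each attached to the path prolonged by \<open>t\<close> or by \<open>t\<close>
  and \<open>b\<close>; their ears become branches at \<open>t\<close> or \<open>b\<close>.\<close>

lemma attached_ear:
  assumes "attached S f n t" "\<forall>x\<in>S. nonlow x"
  shows "ear S f n t"
  using assms
proof (induction "card S" arbitrary: S f n t rule: less_induct)
  case less
  note S = less.prems(1)[unfolded attached_def]
  define b where "b = m t"
  define p where "p = f n"
  have finS: "finite S" and f: "path_upto f n" and tS: "t \<in> S" and tp: "adj t p"
    and Sf: "S \<inter> f ` {..n} = {}" using S by (auto simp: p_def)
  have tb: "adj t b" "adj b t" "b \<in> S" "m b = t" "t \<noteq> b"
    using S mate_mate adj_irrefl unfolding b_def by (metis adj_sym)+
  have mm: "x \<in> S \<Longrightarrow> m (m x) = x" for x using S mate_mate by blast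
  have pS: "p \<notin> S" using Sf by (auto simp: p_def)
  then have pne: "p \<noteq> b" "p \<noteq> m t" using tb b_def by auto
  \<comment> \<open>The edge \<open>tp\<close> is the only one between the matching edge
    \<open>tb\<close> and the one at \<open>p\<close>.\<close>
  have npar: "\<not> adj b p" "\<not> adj t (m p)" "\<not> adj b (m p)"
    using no_parallel'[OF tp] no_parallel[OF tp] pne by (auto simp: b_def)
  have tf: "t \<notin> f ` {..n}" "b \<notin> f ` {..n}" using tS tb Sf by auto
  have step: "adj (f i) (f (Suc i))" if "i < n" for i using f that by (auto simp: path_upto_def)
  let ?S = "S - {t, b}"
  \<comment> \<open>Components of \<open>?S\<close> adjacent to \<open>b\<close> are entered from \<open>b\<close>, the others from \<open>t\<close>.\<close>
  define ft where "ft = f(Suc n := t)"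
  define fb where "fb = ft(Suc (Suc n) := b)"
  have ft: "ft i = f i" "fb i = f i" if "i \<le> n" for i using that by (auto simp: ft_def fb_def)
  have ft': "ft (Suc n) = t" "fb (Suc n) = t" "fb (Suc (Suc n)) = b" by (auto simp: ft_def fb_def)
  have im: "ft ` {..Suc n} = insert t (f ` {..n})"
    "fb ` {..Suc (Suc n)} = insert b (insert t (f ` {..n}))"
    using ft ft' by (auto simp: atMost_Suc)
  have pt: "path_upto ft (Suc n)"
  proof -
    have "inj_on ft {..n}" "ft ` {..n} = f ` {..n}"
      using f ft by (auto simp: path_upto_def inj_on_def)
    then have "inj_on ft {..Suc n}"
      using tf ft' by (simp add: atMost_Suc)
    moreover have "adj (ft i) (ft (Suc i))" if "i < Suc n" for i
      using that step[of i] tp ft ft' by (cases "i = n") (auto simp: p_def intro: adj_sym)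
    ultimately show ?thesis by (simp add: path_upto_def)
  qed
  have pb: "path_upto fb (Suc (Suc n))"
  proof -
    have "fb i = ft i" if "i \<le> Suc n" for i using that by (simp add: fb_def)
    then have "inj_on fb {..Suc n}" "fb ` {..Suc n} = insert t (f ` {..n})"
      using pt im by (auto simp: path_upto_def inj_on_def)
    then have "inj_on fb {..Suc (Suc n)}"
      using tf ft' tb by (simp add: atMost_Suc[of "Suc n"])
    moreover have "adj (fb i) (fb (Suc i))" if i: "i < Suc (Suc n)" for i
    proof -
      consider "i < n" | "i = n" | "i = Suc n" using i by linarith
      then show ?thesis
        using step[of i] tp ft ft' tb by cases (auto simp: p_def intro: adj_sym)
    qed
    ultimately show ?thesis by (simp add: path_upto_def)
  qed
  \<comment> \<open>Both ends of a matching edge are removed together, so the components stay closed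
    under \<open>m\<close> and the induction hypothesis applies to them.\<close>
  have comp: "finite K" "conn K" "\<forall>x\<in>K. m x \<in> K \<and> adj x (m x)" "K \<subseteq> ?S" "card K < card S"
    "\<forall>x\<in>K. \<forall>y. adj x y \<longrightarrow> y \<in> K \<union> insert b (insert t (f ` {..n}))" "\<forall>x\<in>K. nonlow x"
    if K: "K = component_of ?S k" and k: "k \<in> ?S" for K k
  proof -
    show KS: "K \<subseteq> ?S" unfolding K by (rule component_of_subset[OF k])
    show "finite K" using KS finS finite_subset by blast
    show "conn K" unfolding K by (rule conn_component_of[OF k])
    have closed: "y \<in> K" if "x \<in> K" "adj x y" "y \<in> ?S" for x y
      using component_of_closed[OF k] that K by blast
    show "\<forall>x\<in>K. m x \<in> K \<and> adj x (m x)"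
    proof
      fix x assume x: "x \<in> K"
      then have "x \<in> S" "x \<noteq> t" "x \<noteq> b" using KS by auto
      then have "m x \<in> ?S" "adj x (m x)"
        using S mm tb b_def by (metis Diff_iff insertE singletonD)+
      then show "m x \<in> K \<and> adj x (m x)" using closed x by blast
    qed
    show "card K < card S" using KS tS finS by (intro psubset_card_mono) auto
    show "\<forall>x\<in>K. \<forall>y. adj x y \<longrightarrow> y \<in> K \<union> insert b (insert t (f ` {..n}))"
      using closed KS S by blast
    show "\<forall>x\<in>K. nonlow x" using KS less.prems(2) by auto
  qed
  have ear_b: "attached K fb (Suc (Suc n)) s \<and> ear K fb (Suc (Suc n)) s"
    if "K = component_of ?S k" "k \<in> ?S" "s \<in> K" "adj s b" for K k s
  proof -
    note K = comp[OF that(1,2)]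
    have "attached K fb (Suc (Suc n)) s"
      unfolding attached_def im ft' using K that pb Sf by auto
    with less.hyps[OF K(5) this K(7)] show ?thesis by blast
  qed
  \<comment> \<open>A component entered from \<open>b\<close> has \<open>t\<close>, the mate of
    \<open>b\<close>, just before \<open>b\<close> on its path; the second clause of
    \<open>ear\<close> then bars edges to \<open>t\<close>.\<close>
  have not_tb: "\<not> adj s b" if "K = component_of ?S k" "k \<in> ?S" "s \<in> K" "r \<in> K" "adj r t" for K k s r
  proof
    assume "adj s b"
    with ear_b[OF that(1-3)] have "ear K fb (Suc (Suc n)) s" by blast
    then have "fb (Suc n) = m (fb (Suc (Suc n))) \<longrightarrow> (\<forall>x\<in>K. \<not> adj x (fb (Suc n)))"
      unfolding ear_def by blast
    with that ft' tb show False by auto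
  qed
  have ear_t: "attached K ft (Suc n) s \<and> ear K ft (Suc n) s"
    if "K = component_of ?S k" "k \<in> ?S" "s \<in> K" "adj s t" for K k s
  proof -
    note K = comp[OF that(1,2)]
    have "\<not> adj x b" if "x \<in> K" for x
      using not_tb[OF \<open>K = component_of ?S k\<close> \<open>k \<in> ?S\<close> that \<open>s \<in> K\<close> \<open>adj s t\<close>] .
    then have "\<forall>x\<in>K. \<forall>y. adj x y \<longrightarrow> y \<in> K \<union> insert t (f ` {..n})" using K(6) by blast
    then have "attached K ft (Suc n) s"
      unfolding attached_def im ft' using K that pt Sf by auto
    with less.hyps[OF K(5) this K(7)] show ?thesis by blast
  qed
  have N: "y \<in> ?S \<or> (\<exists>i\<le>n. y = f i) \<or> y = t \<or> y = b" if "adj x y" "x \<in> S" for x y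
    using S that by blast
  have branch_b: "\<exists>X lo hi. branch f n b v X lo hi \<and> X \<subseteq> ?S \<and>
      (v \<in> ?S \<longrightarrow> X = component_of ?S v \<and> ear X fb (Suc (Suc n)) v) \<and> (v \<notin> ?S \<longrightarrow> X = {})"
    if v: "adj b v" "v \<noteq> t" for v
  proof (cases "v \<in> ?S")
    case True
    define X where "X = component_of ?S v"
    have v': "v \<in> X" "adj v b" using v by (auto simp: X_def adj_sym)
    note e = ear_b[OF X_def True v']
    \<comment> \<open>The only path vertex between \<open>f n\<close> and \<open>b\<close> is
      \<open>t\<close>, which a component next to \<open>b\<close> does not see.\<close>
    have none: "\<not> adj y (fb i)" if "n < i" "i < Suc (Suc n)" "y \<in> X" for i y
    proof -
      have "i = Suc n" using that by linarith
      then show ?thesis using not_tb[OF X_def True v'(1) that(3)] v'(2) ft' by auto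
    qed
    obtain lo hi where "branch f n b v X lo hi"
      by (rule ear_branch[OF e[THEN conjunct1] e[THEN conjunct2] ft(2) ft'(3)]) (use none in auto)
    with e True comp(4)[OF X_def True] show ?thesis by (auto simp: X_def)
  next
    case False
    then obtain i where "i \<le> n" "v = f i" using N[OF v(1) tb(3)] v adj_irrefl by auto
    then have "branch f n b v {} i i" using v by (auto simp: branch_def)
    with False show ?thesis by blast
  qed
  have branch_t: "\<exists>X lo hi. branch f n t u X lo hi \<and> X \<subseteq> ?S \<and> (\<forall>x\<in>X. \<not> adj x b) \<and>
      (u \<in> ?S \<longrightarrow> X = component_of ?S u \<and> ear X ft (Suc n) u) \<and> (u \<notin> ?S \<longrightarrow> X = {})"
    if u: "adj t u" "u \<noteq> b" for u
  proof (cases "u \<in> ?S")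
    case True
    define X where "X = component_of ?S u"
    have u': "u \<in> X" "adj u t" using u by (auto simp: X_def adj_sym)
    note e = ear_t[OF X_def True u']
    obtain lo hi where "branch f n t u X lo hi"
      by (rule ear_branch[OF e[THEN conjunct1] e[THEN conjunct2] ft(1) ft'(1)]) auto
    with e True comp(4)[OF X_def True] not_tb[OF X_def True _ u'] show ?thesis
      by (auto simp: X_def)
  next
    case False
    then obtain i where "i \<le> n" "u = f i" using N[OF u(1) tS] u adj_irrefl by auto
    then have "branch f n t u {} i i" using u by (auto simp: branch_def)
    with False show ?thesis by blast
  qed
  have disj: "X \<inter> Y = {}"
    if "x \<in> ?S \<longrightarrow> X = component_of ?S x" "x \<notin> ?S \<longrightarrow> X = {}"
      "y \<in> ?S \<longrightarrow> Y = component_of ?S y" "y \<notin> ?S \<longrightarrow> Y = {}" "y \<notin> X" for x y X Y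
    using that component_of_disjoint[of _ ?S x y] by auto
  \<comment> \<open>Two neighbours in one component contradict the first clause of
    \<open>ear\<close>; otherwise they begin disjoint branches, and \<open>b\<close> is linked to
    \<open>p\<close> through \<open>t\<close>.\<close>
  have unique_b: "v1 = v2" if v: "adj b v1" "v1 \<noteq> t" "adj b v2" "v2 \<noteq> t" for v1 v2
  proof -
    from branch_b[OF v(1,2)] obtain X1 lo1 hi1 where 1: "branch f n b v1 X1 lo1 hi1" "X1 \<subseteq> ?S"
      "v1 \<in> ?S \<longrightarrow> X1 = component_of ?S v1 \<and> ear X1 fb (Suc (Suc n)) v1" "v1 \<notin> ?S \<longrightarrow> X1 = {}"
      by blast
    from branch_b[OF v(3,4)] obtain X2 lo2 hi2 where 2: "branch f n b v2 X2 lo2 hi2" "X2 \<subseteq> ?S"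
      "v2 \<in> ?S \<longrightarrow> X2 = component_of ?S v2 \<and> ear X2 fb (Suc (Suc n)) v2" "v2 \<notin> ?S \<longrightarrow> X2 = {}"
      by blast
    show ?thesis
    proof (cases "v2 \<in> X1")
      case True
      then have "ear X1 fb (Suc (Suc n)) v1" using 1 by auto
      then have "\<forall>x\<in>X1. adj x b \<longrightarrow> x = v1" by (simp add: ear_def ft')
      then show ?thesis using True v(3) adj_sym by blast
    next
      case False
      then have d: "X1 \<inter> X2 = {}" using disj[of v1 X1 v2 X2] 1 2 by blast
      have "reach b {t} (f n)" using tb tp by (auto simp: reach_def p_def)
      moreover have "{t} \<inter> (insert b (X1 \<union> X2) \<union> f ` {..n}) = {}"
        using 1 2 tf tb by auto
      ultimately show ?thesis using branch_unique[OF f tf(2) 1(1) 2(1) d, of "{t}"] by simp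
    qed
  qed
  \<comment> \<open>Here the link to \<open>f n\<close> is the edge \<open>tp\<close> itself, with
    no inner vertices, so \<open>p\<close> must be left out.\<close>
  have unique_t: "u1 = u2" if u: "adj t u1" "u1 \<noteq> b" "u1 \<noteq> p" "adj t u2" "u2 \<noteq> b" "u2 \<noteq> p" for u1 u2
  proof -
    from branch_t[OF u(1,2)] obtain X1 lo1 hi1 where 1: "branch f n t u1 X1 lo1 hi1" "X1 \<subseteq> ?S"
      "u1 \<in> ?S \<longrightarrow> X1 = component_of ?S u1 \<and> ear X1 ft (Suc n) u1" "u1 \<notin> ?S \<longrightarrow> X1 = {}"
      by blast
    from branch_t[OF u(4,5)] obtain X2 lo2 hi2 where 2: "branch f n t u2 X2 lo2 hi2" "X2 \<subseteq> ?S"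
      "u2 \<in> ?S \<longrightarrow> X2 = component_of ?S u2 \<and> ear X2 ft (Suc n) u2" "u2 \<notin> ?S \<longrightarrow> X2 = {}"
      by blast
    show ?thesis
    proof (cases "u2 \<in> X1")
      case True
      then have "ear X1 ft (Suc n) u1" using 1 by auto
      then have "\<forall>x\<in>X1. adj x t \<longrightarrow> x = u1" by (simp add: ear_def ft')
      then show ?thesis using True u(4) adj_sym by blast
    next
      case False
      then have d: "X1 \<inter> X2 = {}" using disj[of u1 X1 u2 X2] 1 2 by blast
      have "reach t {} (f n)" using tp by (auto simp: reach_def p_def)
      then show ?thesis using branch_unique[OF f tf(1) 1(1) 2(1) d, of "{}"] u by (auto simp: p_def)
    qed
  qed
  \<comment> \<open>Outside \<open>tb\<close>, its neighbours are \<open>p\<close>, at most one more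
    from \<open>t\<close> and at most one from \<open>b\<close>. Since there are at least three,
    both of the latter exist.\<close>
  have "\<exists>u. adj t u \<and> u \<noteq> b \<and> u \<noteq> p" and "\<exists>v. adj b v \<and> v \<noteq> t"
  proof -
    let ?N = "{y. adj t y \<or> adj b y} - {t, b}"
    have c: "3 \<le> card ?N" using less.prems(2) tS by (auto simp: nonlow_def b_def)
    have no: "\<not> ?N \<subseteq> {p, y}" for y
    proof
      assume "?N \<subseteq> {p, y}"
      then have "card ?N \<le> card {p, y}" by (intro card_mono) auto
      also have "\<dots> \<le> 2" by (simp add: card_insert_if)
      finally show False using c by simp
    qed
    show "\<exists>u. adj t u \<and> u \<noteq> b \<and> u \<noteq> p"
    proof (rule ccontr)
      assume *: "\<nexists>u. adj t u \<and> u \<noteq> b \<and> u \<noteq> p"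
      obtain v where "\<forall>y. adj b y \<longrightarrow> y = t \<or> y = v" using unique_b by metis
      with * have "?N \<subseteq> {p, v}" by blast
      with no show False by blast
    qed
    show "\<exists>v. adj b v \<and> v \<noteq> t"
    proof (rule ccontr)
      assume *: "\<nexists>v. adj b v \<and> v \<noteq> t"
      obtain u where "\<forall>y. adj t y \<longrightarrow> y = b \<or> y = p \<or> y = u" using unique_t by metis
      with * have "?N \<subseteq> {p, u}" by blast
      with no show False by blast
    qed
  qed
  then obtain u v where u: "adj t u" "u \<noteq> b" "u \<noteq> p" and v: "adj b v" "v \<noteq> t" by blast
  from branch_t[OF u(1,2)] obtain X lo hi where X: "branch f n t u X lo hi" "X \<subseteq> ?S"
    "\<forall>x\<in>X. \<not> adj x b" "u \<in> ?S \<longrightarrow> X = component_of ?S u \<and> ear X ft (Suc n) u" "u \<notin> ?S \<longrightarrow> X = {}"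
    by blast
  from branch_b[OF v] obtain Y lo' l where Y: "branch f n b v Y lo' l" "Y \<subseteq> ?S"
    "v \<in> ?S \<longrightarrow> Y = component_of ?S v \<and> ear Y fb (Suc (Suc n)) v" "v \<notin> ?S \<longrightarrow> Y = {}"
    by blast
  have "v \<notin> X" using X(3) v adj_sym by blast
  then have XY: "X \<inter> Y = {}" using disj[of u X v Y] X(4,5) Y(3,4) by blast
  \<comment> \<open>As \<open>S\<close> is connected, every component of \<open>?S\<close> has an
    edge to \<open>t\<close> or \<open>b\<close>, hence by uniqueness contains \<open>u\<close> or
    \<open>v\<close>.\<close>
  have cover: "S = {t, b} \<union> X \<union> Y"
  proof (intro equalityI subsetI)
    fix x assume x: "x \<in> S"
    show "x \<in> {t, b} \<union> X \<union> Y"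
    proof (cases "x \<in> ?S")
      case True
      define K where "K = component_of ?S x"
      have "x \<in> K" "K \<subseteq> ?S" using comp(4)[OF K_def True] by (auto simp: K_def)
      moreover have "conn S" using S by simp
      moreover have "K \<noteq> S" "K \<subseteq> S" using \<open>K \<subseteq> ?S\<close> tS by auto
      ultimately obtain y z where yz: "y \<in> K" "z \<in> S - K" "adj y z"
        using conn_exit[of S K] by blast
      have "y \<in> ?S" using yz(1) \<open>K \<subseteq> ?S\<close> by auto
      have "z \<notin> ?S" using component_of_closed[OF True, of y z] yz by (auto simp: K_def)
      then consider "adj t y" | "adj b y" using yz adj_sym by blast
      then have "y = u \<or> y = v"
        using unique_t[OF _ _ _ u, of y] unique_b[OF _ _ v, of y] pS \<open>y \<in> ?S\<close> by cases auto
      then show ?thesis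
        using \<open>y \<in> ?S\<close> yz(1) component_of_disjoint[of y ?S y x] X(4) Y(3) unfolding K_def by auto
    qed (use x in auto)
  qed (use tS tb X(2) Y(2) in auto)
  \<comment> \<open>A link from \<open>t\<close> through \<open>b\<close> returning too far up would
    make \<open>tu\<close> a chord. For a back edge \<open>lo = hi\<close>, so \<open>lo < k\<close>
    is the stronger bound; for a part \<open>X\<close> it is \<open>hi \<le> k\<close>.\<close>
  have exits_b: "hi \<le> k \<and> lo < k" if y: "y \<in> insert b Y" "adj y (f k)" "k \<le> n" for y k
  proof (rule ccontr)
    assume neg: "\<not> (hi \<le> k \<and> lo < k)"
    have "conn (insert b Y)" using reach_source[OF branch_reach(1)[OF Y(1)]] by simp
    then have W: "reach t (insert b Y) (f k)" using y tb by (auto simp: reach_def)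
    have le: "hi \<le> n" using X(1) by (auto simp: branch_def)
    show False
    proof (rule no_branch_between[OF f tf(1) le_refl X(1) _ W])
      show "reach t {} (f n)" using tp by (auto simp: reach_def p_def)
      show "({} \<union> insert b Y) \<inter> (insert t X \<union> f ` {..n}) = {}"
        using XY X(2) Y(2) tb Sf by auto
      show "X \<noteq> {} \<Longrightarrow> k < hi \<and> hi \<le> n"
        using neg le X(1) by (auto simp: branch_def)
      show "X = {} \<Longrightarrow> (k < hi \<or> k = hi \<and> insert b Y \<noteq> {}) \<and> (hi < n \<or> hi = n \<and> {} \<noteq> {})"
        using neg le X(1) u by (auto simp: branch_def p_def le_less)
    qed simp
  qed
  have exit_t: "\<exists>w\<in>insert t X. adj w (f lo)" "\<exists>w\<in>insert t X. adj w (f hi)" "conn (insert t X)"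
    using reach_source branch_reach[OF X(1)] by blast+
  \<comment> \<open>Otherwise \<open>b\<close>, \<open>t\<close> and \<open>X\<close> link
    \<open>v\<close> to \<open>f lo\<close>, which by \<open>exits_b\<close> is above everything
    that \<open>Y\<close> sees, against the last clause of the ear of \<open>Y\<close>.\<close>
  have "Y = {}"
  proof (rule ccontr)
    assume "Y \<noteq> {}"
    then have vS: "v \<in> ?S" and Yv: "Y = component_of ?S v" and ear: "ear Y fb (Suc (Suc n)) v"
      using Y by auto
    have vY: "v \<in> Y" using Yv by simp
    define Z where "Z = insert b (insert t X)"
    have "Z \<inter> Y = {}" using XY Y(2) by (auto simp: Z_def)
    moreover have "lo \<le> n" using X(1) branch_reach(3)[OF X(1)] by (auto simp: branch_def)
    then have "reach v Z (fb lo)"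
      using exit_t conn_insert[OF exit_t(3), of t b] tb v adj_sym ft
      by (auto simp: reach_def Z_def)
    moreover have "lo < i \<and> fb ` {..i} \<inter> Z = {}"
      if "x \<in> Y" "i < Suc (Suc n)" "adj x (fb i)" for x i
    proof -
      have "\<not> adj x t" using not_tb[OF Yv vS vY that(1)] v adj_sym by blast
      then have "i \<noteq> Suc n" using that ft' by auto
      then have i: "i \<le> n" using that by simp
      then have "fb ` {..i} \<subseteq> f ` {..n}" using ft by auto
      moreover have "f ` {..n} \<inter> Z = {}" using tf X(2) Sf by (auto simp: Z_def)
      ultimately show ?thesis using exits_b[of x i] that i ft by auto
    qed
    ultimately show False by (rule ear_no_link[OF ear])
  qed
  then have vl: "v = f l" "l \<le> n" using Y(1) by (auto simp: branch_def)
  then have "l \<noteq> n" using npar v by (auto simp: p_def)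
  then have l: "l < n" using vl by simp
  have hil: "hi \<le> l" "lo < l" using exits_b[of b l] v vl by auto
  have Nb: "adj b y \<Longrightarrow> y \<noteq> t \<Longrightarrow> y = f l" for y using unique_b[OF _ _ v] vl by blast
  have S': "S = {t, b} \<union> X" using cover \<open>Y = {}\<close> by simp
  have exX: "x \<in> X \<Longrightarrow> i \<le> n \<Longrightarrow> adj x (f i) \<Longrightarrow> i \<le> l" for x i
    using X(1) hil by (fastforce simp: branch_def)
  have exits: "i \<le> l" if "x \<in> S" "i < n" "adj x (f i)" for x i
  proof -
    have fi: "f i \<notin> S" "f i \<noteq> p" using that Sf f by (auto simp: p_def path_upto_eq)
    from that(1) S' consider "x = t" | "x = b" | "x \<in> X" by blast
    then show ?thesis
    proof cases
      case 1
      then have "f i = u" using unique_t[OF _ _ _ u] that fi tb by auto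
      then have "f i = f hi" using X fi by (auto simp: branch_def)
      then show ?thesis using hil l that f by (auto simp: path_upto_eq)
    next
      case 2
      then have "f i = f l" using Nb that fi tS by auto
      then show ?thesis using l that f by (auto simp: path_upto_eq)
    next
      case 3
      then show ?thesis using exX that by auto
    qed
  qed
  have "x = t" if "x \<in> S" "adj x (f n)" for x
    using that S' npar exX[of x n] l by (auto simp: p_def)
  \<comment> \<open>Here \<open>f k\<close> is the mate of \<open>p\<close>, so neither
    \<open>t\<close> nor \<open>b\<close> sees it. In particular \<open>l \<noteq> k\<close>, hence
    \<open>l < k\<close>, which is beyond the exits of \<open>X\<close>.\<close>
  moreover have "\<not> adj x (f k)" if "n = Suc k" "f k = m (f n)" "x \<in> S" for x k
  proof
    assume a: "adj x (f k)"
    have "f k = m p" using that by (simp add: p_def)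
    then have "x \<in> X" and "l \<noteq> k" using a npar S' that v vl by auto
    then show False using exits[OF that(3) _ a] that l exX a hil X(1) by (auto simp: branch_def)
  qed
  \<comment> \<open>One path goes through \<open>u\<close> to the upper end of its branch, the other
    through \<open>b\<close> along its back edge.\<close>
  moreover have "fan t S f lo l"
    unfolding fan_def
  proof (intro exI conjI)
    show "reach t X (f lo)" by (rule branch_reach[OF X(1)])
    show "reach t {b} (f l)" using tb v vl by (auto simp: reach_def)
  qed (use X(2) tb in auto)
  \<comment> \<open>With \<open>Z\<close> as upper and \<open>b\<close> as lower link,
    \<open>tu\<close> would be a chord. The path is cut at \<open>l\<close>, since \<open>Z\<close>
    is known to avoid it only that far.\<close>
  moreover have False if Z: "Z \<inter> S = {}" "reach t Z (f k)"
    "\<forall>x\<in>S. \<forall>i<n. adj x (f i) \<longrightarrow> k < i \<and> f ` {..i} \<inter> Z = {}" for Z k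
  proof -
    have kl: "k < l" "f ` {..l} \<inter> Z = {}" using Z(3) tb v vl l by auto
    have khi: "k < hi" using Z(3) exit_t(2) S' hil l by fastforce
    have sub: "f ` {..l} \<subseteq> f ` {..n}" using l by auto
    show False
    proof (rule no_branch_between[OF path_upto_mono[OF f vl(2)] _ vl(2) X(1) _ Z(2)])
      show "t \<notin> f ` {..l}" using tf sub by blast
      show "reach t {b} (f l)" using tb v vl by (auto simp: reach_def)
      show "{b} \<inter> Z = {}" using Z(1) tb by auto
      show "({b} \<union> Z) \<inter> (insert t X \<union> f ` {..l}) = {}"
        using Z(1) kl sub tf tb X(2) S' by auto
    qed (use khi hil in auto)
  qed
  ultimately show ?case
    using hil(2) l exits unfolding ear_def by blast
qed

section \<open>The search at its root edge\<close>

lemma nonlow_part_not_adj_root: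
  assumes S: "finite S" "conn S" "\<forall>x\<in>S. m x \<in> S \<and> adj x (m x)" "\<forall>x\<in>S. nonlow x"
    and r: "adj r (m r)" "r \<notin> S" "m r \<notin> S" "\<forall>x\<in>S. \<forall>y. adj x y \<longrightarrow> y \<in> S \<union> {r, m r}"
    and s: "s \<in> S" "adj s r"
  shows False
proof -
  define f where "f = (\<lambda>i::nat. if i = 0 then m r else r)"
  have ne: "r \<noteq> m r" using r(1) adj_irrefl by metis
  have im: "f ` {..Suc 0} = {r, m r}" by (auto simp: f_def atMost_Suc)
  have "attached S f (Suc 0) s"
    using S r s ne im
    by (auto simp: attached_def path_upto_def f_def inj_on_def adj_sym)
  then have "ear S f (Suc 0) s" using attached_ear S(4) by blast
  \<comment> \<open>The path is just \<open>m r, r\<close>, so \<open>ear\<close> asks for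
    \<open>lo < hi < 1\<close>.\<close>
  then show False by (auto simp: ear_def)
qed

lemma nonlow_part_not_adj_root_edge:
  assumes S: "finite S" "conn S" "\<forall>x\<in>S. m x \<in> S \<and> adj x (m x)" "\<forall>x\<in>S. nonlow x"
    and r: "adj r (m r)" "r \<notin> S" "m r \<notin> S" "\<forall>x\<in>S. \<forall>y. adj x y \<longrightarrow> y \<in> S \<union> {r, m r}"
    and s: "s \<in> S" "adj s r \<or> adj s (m r)"
  shows False
  using s(2)
proof
  assume "adj s (m r)"
  moreover have "m (m r) = r" using mate_mate r(1) .
  ultimately show False
    using nonlow_part_not_adj_root[OF S, of "m r" s] r s(1) adj_sym by (simp add: insert_commute)
qed (use nonlow_part_not_adj_root[OF S r s(1)] in blast)

text \<open>The edge that may violate the degree condition is taken as root, so that every part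
  below it consists of vertices satisfying \<open>nonlow\<close>.\<close>

lemma nonlow_except_root:
  assumes V: "finite V" "\<forall>x\<in>V. m x \<in> V \<and> adj x (m x)" "\<forall>x\<in>V. \<forall>y. adj x y \<longrightarrow> y \<in> V"
    and r: "r \<in> V" and nonlow: "\<forall>x\<in>V - {r, m r}. nonlow x"
  shows "V = {r, m r}"
proof (rule ccontr)
  have comp: "finite K \<and> conn K \<and> (\<forall>x\<in>K. m x \<in> K \<and> adj x (m x)) \<and> K \<subseteq> U - {a, m a} \<and> k \<in> K \<and>
      (\<forall>x\<in>K. \<forall>y. adj x y \<longrightarrow> y \<in> K \<union> {a, m a})"
    if U: "finite U" "\<forall>x\<in>U. m x \<in> U \<and> adj x (m x)" "\<forall>x\<in>U. \<forall>y. adj x y \<longrightarrow> y \<in> U"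
      and a: "a \<in> U" and k: "k \<in> U - {a, m a}" and K: "K = component_of (U - {a, m a}) k"
    for U a k K
  proof -
    have KU: "K \<subseteq> U - {a, m a}" unfolding K by (rule component_of_subset[OF k])
    have closed: "y \<in> K" if "x \<in> K" "adj x y" "y \<in> U - {a, m a}" for x y
      using component_of_closed[OF k] that K by blast
    have "m x \<in> K \<and> adj x (m x)" if x: "x \<in> K" for x
    proof -
      have x': "x \<in> U" "x \<noteq> a" "x \<noteq> m a" using KU x by auto
      have "m (m x) = x" "m (m a) = a" using U x' a mate_mate by blast+
      then have "m x \<in> U - {a, m a}" "adj x (m x)" using U x' by auto
      then show ?thesis using closed x by blast
    qed
    moreover have "finite K" using KU U(1) finite_subset by blast
    moreover have "conn K" unfolding K by (rule conn_component_of[OF k])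
    moreover have "k \<in> K" unfolding K by simp
    moreover have "\<forall>x\<in>K. \<forall>y. adj x y \<longrightarrow> y \<in> K \<union> {a, m a}"
      using KU closed U(3) by blast
    ultimately show ?thesis using KU by blast
  qed
  assume "V \<noteq> {r, m r}"
  then obtain k where k: "k \<in> V - {r, m r}" using r V by blast
  define K where "K = component_of (V - {r, m r}) k"
  note cK = comp[OF V r k K_def]
  show False
  proof (cases "\<exists>s\<in>K. adj s r \<or> adj s (m r)")
    case True
    then obtain s where s: "s \<in> K" "adj s r \<or> adj s (m r)" by blast
    have sub: "K \<subseteq> V - {r, m r}" using cK by simp
    show False
    proof (rule nonlow_part_not_adj_root_edge[OF _ _ _ _ _ _ _ _ s])
      show "\<forall>x\<in>K. nonlow x" using sub nonlow by blast
      show "r \<notin> K" "m r \<notin> K" using sub by auto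
      show "adj r (m r)" using V r by blast
    qed (use cK in simp_all)
  next
    case False
    \<comment> \<open>The part \<open>K\<close> does not meet the exceptional edge, so any edge inside it can be the root.\<close>
    then have cl: "\<forall>x\<in>K. \<forall>y. adj x y \<longrightarrow> y \<in> K" using cK by blast
    have kK: "k \<in> K" using cK by blast
    \<comment> \<open>Used only to find a neighbour outside the new root edge, that is, a nonempty
      part attached to it.\<close>
    have "3 \<le> card ({y. adj k y \<or> adj (m k) y} - {k, m k})"
      using nonlow k by (auto simp: nonlow_def)
    then have "{y. adj k y \<or> adj (m k) y} - {k, m k} \<noteq> {}"
      by (metis card.empty not_numeral_le_zero)
    then obtain y where y: "adj k y \<or> adj (m k) y" "y \<noteq> k" "y \<noteq> m k" by blast
    then have yK: "y \<in> K - {k, m k}" using cl kK cK by blast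
    define L where "L = component_of (K - {k, m k}) y"
    have cL: "finite L \<and> conn L \<and> (\<forall>x\<in>L. m x \<in> L \<and> adj x (m x)) \<and> L \<subseteq> K - {k, m k} \<and> y \<in> L \<and>
      (\<forall>x\<in>L. \<forall>y. adj x y \<longrightarrow> y \<in> L \<union> {k, m k})"
      using comp[OF _ _ cl kK yK L_def] cK by blast
    show False
    proof (rule nonlow_part_not_adj_root_edge[of L k y])
      have "L \<subseteq> K - {k, m k}" "K \<subseteq> V - {r, m r}" using cL cK by simp_all
      then show "\<forall>x\<in>L. nonlow x" using nonlow by blast
      show "adj k (m k)" using cK kK by blast
      show "adj y k \<or> adj y (m k)" using y(1) adj_sym by blast
    qed (use cL in blast)+
  qed
qed

end

section \<open>From subgraphs of the contraction to the search\<close>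

theorem theorem4:
  fixes G :: "'a ugraph" and M :: "'a set set" and H :: "'a set ugraph"
  assumes "simple_graph G"
    and "chordless G"
    and "is_matching G M"
    and "is_subgraph H (matching_contraction G M)"
    and "2 \<le> card (gverts H)"
  shows "2 \<le> card {v \<in> gverts H. gdegree H v \<le> 2}"
proof (rule ccontr)
  assume few: "\<not> 2 \<le> card {v \<in> gverts H. gdegree H v \<le> 2}"
  let ?M = "gverts H"
  have finM: "finite ?M" and MM: "?M \<subseteq> M" and HE: "\<forall>h\<in>gedges H. h \<subseteq> ?M"
    using assms(4) by (auto simp: is_subgraph_def simple_graph_def matching_contraction_def)
  have disj: "e = f" if "e \<in> ?M" "f \<in> ?M" "x \<in> e" "x \<in> f" for e f x
    using MM assms(3) that unfolding is_matching_def by blast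
  have ME: "?M \<subseteq> gedges G"
    using MM assms(3) by (auto simp: is_matching_def)
  have card2: "e \<subseteq> gverts G \<and> card e = 2" if "e \<in> ?M" for e
    using ME that assms(1) by (auto simp: simple_graph_def)
  have "\<forall>h\<in>gedges H. \<exists>d. \<exists>e f x y. h = {e, f} \<and> e \<noteq> f \<and> e \<in> ?M \<and> f \<in> ?M \<and> x \<in> e \<and> y \<in> f \<and>
      d = {x, y} \<and> {x, y} \<in> gedges G"
  proof
    fix h assume h: "h \<in> gedges H"
    then have "h \<in> gedges (matching_contraction G M)"
      using assms(4) by (auto simp: is_subgraph_def)
    then obtain e f x y where "h = {e, f}" "e \<noteq> f" "x \<in> e" "y \<in> f" "{x, y} \<in> gedges G"
      unfolding matching_contraction_def matching_subgraph_def induced_by_def by auto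
    moreover from this h HE have "e \<in> ?M" "f \<in> ?M" by auto
    ultimately show "\<exists>d. \<exists>e f x y. h = {e, f} \<and> e \<noteq> f \<and> e \<in> ?M \<and> f \<in> ?M \<and> x \<in> e \<and> y \<in> f \<and>
      d = {x, y} \<and> {x, y} \<in> gedges G" by blast
  qed
  then obtain c where c: "\<And>h. h \<in> gedges H \<Longrightarrow> \<exists>e f x y. h = {e, f} \<and> e \<noteq> f \<and> e \<in> ?M \<and> f \<in> ?M \<and>
      x \<in> e \<and> y \<in> f \<and> c h = {x, y} \<and> {x, y} \<in> gedges G"
    by (rule bchoice[THEN exE]) blast
  define V where "V = \<Union>?M"
  define G' where "G' = (V, ?M \<union> c ` gedges H)"
  define adj where "adj x y \<longleftrightarrow> {x, y} \<in> gedges G'" for x y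
  \<comment> \<open>Matching edges are disjoint, so the mate is unique on \<open>V\<close>;
    elsewhere \<open>m\<close> is unspecified, but the locale constrains it only at ends of
    edges.\<close>
  define m where "m x = (THE y. {x, y} \<in> ?M)" for x
  have c_sub: "c h \<subseteq> V" "c h \<in> gedges G" if h: "h \<in> gedges H" for h
    using c[OF h] by (auto simp: V_def)
  have VG: "V \<subseteq> gverts G" using card2 by (auto simp: V_def)
  have sub: "gedges G' \<subseteq> gedges G" using ME c_sub(2) by (auto simp: G'_def)
  have "finite V" using VG assms(1) finite_subset by (auto simp: simple_graph_def)
  have simple: "simple_graph G'"
    unfolding simple_graph_def
  proof (intro conjI ballI)
    fix e assume e: "e \<in> gedges G'"
    show "e \<subseteq> gverts G'" using e c_sub(1) by (auto simp: G'_def V_def)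
    show "card e = 2" using e sub assms(1) by (auto simp: simple_graph_def)
  qed (simp add: G'_def \<open>finite V\<close>)
  have chordless: "chordless G'"
    unfolding chordless_def
  proof (intro allI impI notI)
    fix d assume d: "is_cycle G' d" "\<exists>e. is_chord G' d e"
    have "gverts G' \<subseteq> gverts G" using VG by (simp add: G'_def)
    then have "is_cycle G d" using d(1) sub by (auto simp: is_cycle_def)
    moreover have "\<exists>e. is_chord G d e" using d(2) sub by (auto simp: is_chord_def)
    ultimately show False using assms(2) by (auto simp: chordless_def)
  qed
  have mate: "e = {x, m x} \<and> m x \<noteq> x" if "e \<in> ?M" "x \<in> e" for e x
  proof -
    from card2[OF that(1)] that(2) obtain y where y: "e = {x, y}" "y \<noteq> x"
      by (auto simp: card_2_iff)
    have "m x = y"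
      unfolding m_def
    proof (rule the_equality)
      fix z assume "{x, z} \<in> ?M"
      then have "{x, z} = e" using disj[of _ e x] that by auto
      then show "z = y" using y by (auto simp: doubleton_eq_iff)
    qed (use y that in simp)
    with y show ?thesis by simp
  qed
  have mate_V: "m x \<in> V" "adj x (m x)" "m (m x) = x" if x: "x \<in> V" for x
  proof -
    from x obtain e where e: "e \<in> ?M" "x \<in> e" by (auto simp: V_def)
    note xe = mate[OF e]
    then have "m x \<in> e" by auto
    then show "m x \<in> V" using e by (auto simp: V_def)
    show "adj x (m x)" using xe e by (auto simp: adj_def G'_def)
    show "m (m x) = x" using mate[OF e(1) \<open>m x \<in> e\<close>] xe by (auto simp: doubleton_eq_iff)
  qed
  have adj_V: "x \<in> V" "y \<in> V" "x \<noteq> y" if "adj x y" for x y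
  proof -
    have "{x, y} \<subseteq> V \<and> card {x, y} = 2"
      using that simple by (auto simp only: adj_def simple_graph_def G'_def fst_conv)
    then show "x \<in> V" "y \<in> V" "x \<noteq> y" by auto
  qed
  have adj_cases: "{x, y} \<in> ?M \<or> (\<exists>e f. e \<in> ?M \<and> f \<in> ?M \<and> e \<noteq> f \<and> x \<in> e \<and> y \<in> f \<and> c {e, f} = {x, y})"
    if xy: "adj x y" for x y
  proof (cases "{x, y} \<in> ?M")
    case False
    then obtain h where h: "h \<in> gedges H" "c h = {x, y}" using xy by (auto simp: adj_def G'_def)
    from c[OF h(1)] obtain e f x' y' where *: "h = {e, f}" "e \<noteq> f" "e \<in> ?M" "f \<in> ?M" "x' \<in> e" "y' \<in> f"
      "c h = {x', y'}" by blast
    with h(2) have "x = x' \<and> y = y' \<or> x = y' \<and> y = x'" by (auto simp: doubleton_eq_iff)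
    then show ?thesis using * h by (metis insert_commute)
  qed simp
  \<comment> \<open>An edge between distinct matching edges is determined by them, being the one
    chosen by \<open>c\<close>; this yields \<open>no_parallel\<close>.\<close>
  have cross: "c {e, f} = {x, y}" if "adj x y" "e \<in> ?M" "f \<in> ?M" "e \<noteq> f" "x \<in> e" "y \<in> f" for x y e f
  proof -
    have "{x, y} \<notin> ?M" using disj[of "{x, y}" e x] disj[of "{x, y}" f y] that by auto
    with adj_cases[OF that(1)]
    obtain e' f' where "e' \<in> ?M" "f' \<in> ?M" "x \<in> e'" "y \<in> f'" "c {e', f'} = {x, y}"
      by blast
    moreover from this have "e' = e" "f' = f" using disj that by blast+
    ultimately show ?thesis by simp
  qed
  have parts: "\<exists>e f. e \<in> ?M \<and> f \<in> ?M \<and> e \<noteq> f \<and> e = {x, m x} \<and> f = {y, m y} \<and> m x \<noteq> x \<and> m y \<noteq> y"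
    if "adj x y" "y \<noteq> m x" for x y
  proof -
    have "{x, y} \<notin> ?M" using mate[of "{x, y}" x] that adj_V[OF that(1)] by (auto simp: doubleton_eq_iff)
    with adj_cases[OF that(1)] obtain e f where ef: "e \<in> ?M" "f \<in> ?M" "e \<noteq> f" "x \<in> e" "y \<in> f"
      by blast
    show ?thesis
      using ef mate[OF ef(1,4)] mate[OF ef(2,5)] by (intro exI[of _ e] exI[of _ f]) simp
  qed
  interpret chordless_mate adj m
  proof
    show "adj x y \<Longrightarrow> adj y x" for x y by (simp add: adj_def insert_commute)
    then interpret sym_graph adj by unfold_locales
    show "\<not> adj x x" for x using adj_V by blast
    show False
      if "adj x u" "conn A" "conn B" "A \<inter> B = {}" "x \<notin> A \<union> B" "u \<notin> A \<union> B" "\<exists>a\<in>A. adj x a"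
        "\<exists>a\<in>A. adj a u" "\<exists>b\<in>B. adj x b" "\<exists>b\<in>B. adj b u" for x u A B
    proof -
      have eq: "adj = (\<lambda>x y. {x, y} \<in> gedges G')" by (auto simp: adj_def fun_eq_iff)
      from that obtain a a' b b' where *: "a \<in> A" "adj x a" "a' \<in> A" "adj a' u" "b \<in> B" "adj u b"
        "b' \<in> B" "adj b' x" using adj_sym by blast
      show False
        by (rule chordless_no_two_links[OF simple chordless, folded eq, of x u A a a' B b b'])
          (use that * in \<open>simp_all flip: adj_def\<close>)
    qed
    show "adj x y \<Longrightarrow> adj x (m x)" "adj x y \<Longrightarrow> m (m x) = x" for x y
      using adj_V mate_V by blast+
    show "\<not> adj x (m y)" if xy: "adj x y" "y \<noteq> m x" for x y
    proof
      assume a: "adj x (m y)"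
      obtain e f where *: "e \<in> ?M" "f \<in> ?M" "e \<noteq> f" "e = {x, m x}" "f = {y, m y}" "m y \<noteq> y"
        using parts[OF xy] by blast
      then show False
        using cross[OF a, of e f] cross[OF xy(1), of e f] by (auto simp: doubleton_eq_iff)
    qed
    show "\<not> adj (m x) (m y)" if xy: "adj x y" "y \<noteq> m x" for x y
    proof
      assume a: "adj (m x) (m y)"
      obtain e f where *: "e \<in> ?M" "f \<in> ?M" "e \<noteq> f" "e = {x, m x}" "f = {y, m y}" "m x \<noteq> x"
        using parts[OF xy] by blast
      then show False
        using cross[OF a, of e f] cross[OF xy(1), of e f] xy(2) by (auto simp: doubleton_eq_iff)
    qed
  qed
  \<comment> \<open>Each edge \<open>h\<close> of \<open>H\<close> at \<open>e\<close> is sent to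
    the end of \<open>c h\<close> outside \<open>e\<close>. This is injective, since that end lies
    in a unique matching edge, the other end of \<open>h\<close>.\<close>
  have high: "nonlow x" if e: "e \<in> ?M" "x \<in> e" and deg: "\<not> gdegree H e \<le> 2" for e x
  proof -
    let ?D = "{h \<in> gedges H. e \<in> h}"
    let ?N = "{y. adj x y \<or> adj (m x) y} - {x, m x}"
    have ex: "e = {x, m x}" using mate[OF e] by simp
    have "\<forall>h\<in>?D. \<exists>y. y \<in> ?N \<and> (\<exists>f\<in>?M. h = {e, f} \<and> y \<in> f)"
    proof
      fix h assume h: "h \<in> ?D"
      then have "h \<in> gedges H" by simp
      from c[OF this]
      obtain e' f' x' y' where *: "h = {e', f'}" "e' \<noteq> f'" "e' \<in> ?M" "f' \<in> ?M" "x' \<in> e'" "y' \<in> f'"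
        "c h = {x', y'}" by blast
      then have "adj x' y'" using h by (auto simp: adj_def G'_def)
      moreover have "e = e' \<or> e = f'" using * h by auto
      ultimately have "\<exists>f z y. h = {e, f} \<and> f \<in> ?M \<and> f \<noteq> e \<and> z \<in> e \<and> y \<in> f \<and> adj z y"
        using * adj_sym[of x' y'] by (metis insert_commute)
      then obtain f z y where "h = {e, f}" "f \<in> ?M" "f \<noteq> e" "z \<in> e" "y \<in> f" "adj z y"
        by blast
      moreover from this have "y \<notin> e" using disj e by blast
      ultimately show "\<exists>y. y \<in> ?N \<and> (\<exists>f\<in>?M. h = {e, f} \<and> y \<in> f)" using ex by auto
    qed
    then obtain g where g: "\<And>h. h \<in> ?D \<Longrightarrow> g h \<in> ?N \<and> (\<exists>f\<in>?M. h = {e, f} \<and> g h \<in> f)"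
      using bchoice[of ?D "\<lambda>h y. y \<in> ?N \<and> (\<exists>f\<in>?M. h = {e, f} \<and> y \<in> f)"] by blast
    have "inj_on g ?D"
    proof (rule inj_onI)
      fix h h' assume h: "h \<in> ?D" "h' \<in> ?D" "g h = g h'"
      from g[OF h(1)] obtain f where f: "f \<in> ?M" "h = {e, f}" "g h \<in> f" by blast
      from g[OF h(2)] obtain f' where f': "f' \<in> ?M" "h' = {e, f'}" "g h' \<in> f'" by blast
      have "f = f'" using disj[OF f(1) f'(1) f(3)] f'(3) h(3) by simp
      then show "h = h'" using f(2) f'(2) by simp
    qed
    moreover have "g ` ?D \<subseteq> ?N" using g[THEN conjunct1] by (rule image_subsetI)
    moreover have "finite ?N"
      by (rule finite_subset[OF _ \<open>finite V\<close>]) (use adj_V in auto)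
    ultimately have "card ?D \<le> card ?N" by (rule card_inj_on_le)
    then show ?thesis using deg by (simp add: nonlow_def gdegree_def)
  qed
  let ?L = "{v \<in> ?M. gdegree H v \<le> 2}"
  \<comment> \<open>If no vertex of \<open>H\<close> has low degree, any \<open>e\<close> can be the
    root.\<close>
  have "\<exists>e\<in>?M. ?L \<subseteq> {e}"
  proof (cases "?L = {}")
    case True
    have "?M \<noteq> {}" using assms(5) by auto
    then show ?thesis using True by blast
  next
    case False
    then have "card ?L \<noteq> 0" using finM by simp
    then have "card ?L = 1" using few by linarith
    then obtain e where "?L = {e}" by (auto simp: card_1_singleton_iff)
    then show ?thesis by blast
  qed
  then obtain e where e: "e \<in> ?M" "?L \<subseteq> {e}" by blast
  then have "e \<noteq> {}" using card2 by fastforce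
  then obtain r where r: "r \<in> e" by blast
  have er: "e = {r, m r}" using mate[OF e(1) r] by simp
  have "V = {r, m r}"
  proof (rule nonlow_except_root[OF \<open>finite V\<close>])
    show "\<forall>x\<in>V - {r, m r}. nonlow x"
    proof
      fix x assume x: "x \<in> V - {r, m r}"
      then obtain f where f: "f \<in> ?M" "x \<in> f" by (auto simp: V_def)
      then have "f \<notin> ?L" using e(2) x er by blast
      then show "nonlow x" using high[OF f] f by simp
    qed
  qed (use mate_V adj_V r e in \<open>auto simp: V_def\<close>)
  \<comment> \<open>Nothing lies outside the root edge, so \<open>H\<close> has a single vertex,
    contrary to assumption.\<close>
  have "?M \<subseteq> {e}"
  proof
    fix f assume f: "f \<in> ?M"
    then have "f \<noteq> {}" using card2 by fastforce
    then obtain x where "x \<in> f" by blast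
    then show "f \<in> {e}" using disj[OF f e(1), of x] f \<open>V = {r, m r}\<close> er by (auto simp: V_def)
  qed
  then have "card ?M \<le> card {e}" by (intro card_mono) auto
  then show False using assms(5) by simp
qed

end
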